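(* Let $\alpha,\delta\in\mathbb R$, let $X=(X_t)_{t\ge 0}$ be an additive $(\alpha,\delta)$-dilatively stable process, and let $Y=(Y_t)_{t\in\mathbb R}$ be the process given by $$Y_t=\int_1^{e^t}u^{-\alpha+\delta/2}\,dX_u \quad (t\ge 0),\qquad Y_t=-\int_{e^t}^{1}u^{-\alpha+\delta/2}\,dX_u\quad (t<0).$$ Then for any $t>0$ we have $$X_t=\int_{-\infty}^{\log t}e^{u(\alpha-\delta/2)}\,dY_u\quad\text{almost surely.}$$
   Context: All processes are real-valued. Additive process $(X_t)_{t\ge0}$: (i) for any $0\le t_0<t_1<\dots<t_n$ the random variables $X_{t_0},X_{t_1}-X_{t_0},\dots,X_{t_n}-X_{t_{n-1}}$ are independent; (ii) it is stochastically continuous; (iii) almost surely its paths are right-continuous with left limits (càdlàg); (iv) $X_0=0$ almost surely. A process is infinitely divisible if all its finite-dimensional distributions are. For an infinitely divisible process $X$, $\Psi^X_{t_1,\dots,t_k}:\mathbb R^k\to\mathbb C$ denotes the log-characteristic function (Lévy exponent) of $(X_{t_1},\dots,X_{t_k})$, i.e. the unique continuous function with $\Psi^X_{t_1,\dots,t_k}(0,\dots,0)=0$ and $\mathbb E[\exp(i\sum_j\theta_jX_{t_j})]=\exp(\Psi^X_{t_1,\dots,t_k}(\theta_1,\dots,\theta_k))$. An infinitely divisible process $(X_t)_{t\ge0}$ is $(\alpha,\delta)$-dilatively stable if $\Psi^X_{Tt_1,\dots,Tt_k}(\theta_1,\dots,\theta_k)=T^{\delta}\,\Psi^X_{t_1,\dots,t_k}(T^{\alpha-\delta/2}\theta_1,\dots,T^{\alpha-\delta/2}\theta_k)$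 for all $T>0$, $k\in\mathbb N$, $t_1,\dots,t_k\ge0$, $\theta_1,\dots,\theta_k\in\mathbb R$. Random integral: for a process $Y$ with càdlàg paths, a continuously differentiable function $A$ and $a<b$, $\int_a^bA(t)\,dY_t:=A(b)Y_b-A(a)Y_a-\int_a^bA'(t)Y_t\,dt$ (pathwise Riemann integral). $\int_{-\infty}^{b}A(t)\,dY_t$ denotes the almost sure limit of $\int_a^bA(t)\,dY_t$ as $a\downarrow-\infty$ (its existence is part of the claim). *)

theory Defs
  imports "HOL-Probability.Probability"
begin

text \<open>
  A process with index set \<open>[0, \<infinity>)\<close> is a function \<open>X :: real \<Rightarrow> 'a \<Rightarrow> real\<close> of which only the
  values \<open>X t\<close> with \<open>t \<ge> 0\<close> are ever constrained. Vectors of \<open>\<real>\<^sup>k\<close> are the extensional functions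
  in \<open>{..<k} \<rightarrow>\<^sub>E UNIV\<close>, so that \<open>\<real>\<^sup>k\<close> carries the \<open>\<sigma>\<close>-algebra \<open>PiM {..<k} (\<lambda>_. borel)\<close> and the
  topology \<open>powertop_real {..<k}\<close>.
\<close>

definition cadlag_from_0 :: "(real \<Rightarrow> real) \<Rightarrow> bool" where
  "cadlag_from_0 x \<longleftrightarrow>
     (\<forall>t\<ge>0. (x \<longlongrightarrow> x t) (at_right t)) \<and>
     (\<forall>t>0. \<exists>l. (x \<longlongrightarrow> l) (at_left t))"

definition stochastically_continuous :: "'a measure \<Rightarrow> (real \<Rightarrow> 'a \<Rightarrow> real) \<Rightarrow> bool" where
  "stochastically_continuous M X \<longleftrightarrow>
     (\<forall>s\<ge>0. \<forall>\<epsilon>>0.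
        ((\<lambda>t. measure M {\<omega> \<in> space M. \<bar>X t \<omega> - X s \<omega>\<bar> > \<epsilon>}) \<longlongrightarrow> 0) (at s within {0..}))"

definition additive_process :: "'a measure \<Rightarrow> (real \<Rightarrow> 'a \<Rightarrow> real) \<Rightarrow> bool" where
  "additive_process M X \<longleftrightarrow>
     (\<forall>t\<ge>0. X t \<in> borel_measurable M) \<and>
     (\<forall>(n::nat) (t :: nat \<Rightarrow> real). 0 \<le> t 0 \<longrightarrow> strict_mono_on {..n} t \<longrightarrow>
        prob_space.indep_vars M (\<lambda>_. borel)
          (\<lambda>i \<omega>. if i = 0 then X (t 0) \<omega> else X (t i) \<omega> - X (t (i - 1)) \<omega>) {..n}) \<and>
     stochastically_continuous M X \<and>
     (AE \<omega> in M. cadlag_from_0 (\<lambda>t. X t \<omega>)) \<and>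
     (AE \<omega> in M. X 0 \<omega> = 0)"

text \<open>A law \<open>\<mu>\<close> on \<open>\<real>\<^sup>k\<close> is infinitely divisible if, for every \<open>n \<ge> 1\<close>, it is the law of the sum
  of \<open>n\<close> independent random vectors with a common law \<open>\<nu>\<close>, that is, \<open>\<mu> = \<nu> * \<dots> * \<nu>\<close>.\<close>

definition infinitely_divisible_law :: "nat \<Rightarrow> (nat \<Rightarrow> real) measure \<Rightarrow> bool" where
  "infinitely_divisible_law k \<mu> \<longleftrightarrow>
     (\<forall>n::nat. 1 \<le> n \<longrightarrow> (\<exists>\<nu>. prob_space \<nu> \<and> sets \<nu> = sets (PiM {..<k} (\<lambda>_. borel :: real measure)) \<and>
        \<mu> = distr (PiM {..<n} (\<lambda>_. \<nu>)) (PiM {..<k} (\<lambda>_. borel))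
              (\<lambda>x. \<lambda>i\<in>{..<k}. \<Sum>j<n. x j i)))"

definition infinitely_divisible_process :: "'a measure \<Rightarrow> (real \<Rightarrow> 'a \<Rightarrow> real) \<Rightarrow> bool" where
  "infinitely_divisible_process M X \<longleftrightarrow>
     (\<forall>t\<ge>0. X t \<in> borel_measurable M) \<and>
     (\<forall>k\<ge>1. \<forall>t. (\<forall>i<k. 0 \<le> t i) \<longrightarrow>
        infinitely_divisible_law k
          (distr M (PiM {..<k} (\<lambda>_. borel)) (\<lambda>\<omega>. \<lambda>i\<in>{..<k}. X (t i) \<omega>)))"

text \<open>The description is proper for every infinitely divisible process: its characteristic functions
  are continuous and have no zeros. Extensionality fixes the irrelevant values outside \<open>\<real>\<^sup>k\<close>.\<close>

definition levy_exponent ::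
    "'a measure \<Rightarrow> (real \<Rightarrow> 'a \<Rightarrow> real) \<Rightarrow> nat \<Rightarrow> (nat \<Rightarrow> real) \<Rightarrow> (nat \<Rightarrow> real) \<Rightarrow> complex" where
  "levy_exponent M X k t = (THE \<Psi>.
     \<Psi> \<in> extensional ({..<k} \<rightarrow>\<^sub>E UNIV) \<and>
     continuous_map (powertop_real {..<k}) euclidean \<Psi> \<and>
     \<Psi> (\<lambda>i\<in>{..<k}. 0) = 0 \<and>
     (\<forall>\<theta> \<in> {..<k} \<rightarrow>\<^sub>E UNIV. (CLINT \<omega>|M. iexp (\<Sum>j<k. \<theta> j * X (t j) \<omega>)) = exp (\<Psi> \<theta>)))"

definition dilatively_stable :: "'a measure \<Rightarrow> real \<Rightarrow> real \<Rightarrow> (real \<Rightarrow> 'a \<Rightarrow> real) \<Rightarrow> bool" where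
  "dilatively_stable M \<alpha> \<delta> X \<longleftrightarrow>
     infinitely_divisible_process M X \<and>
     (\<forall>T>0. \<forall>k\<ge>1. \<forall>t. (\<forall>i<k. 0 \<le> t i) \<longrightarrow>
        (\<forall>\<theta> \<in> {..<k} \<rightarrow>\<^sub>E UNIV.
           levy_exponent M X k (\<lambda>i. T * t i) \<theta> =
           complex_of_real (T powr \<delta>) *
             levy_exponent M X k t (\<lambda>i\<in>{..<k}. T powr (\<alpha> - \<delta> / 2) * \<theta> i)))"

text \<open>Integral of \<open>A\<close> along a single path \<open>y\<close>, for \<open>a \<le> b\<close>, \<open>A\<close> continuously differentiable near
  \<open>[a, b]\<close> and \<open>y\<close> right-continuous with left limits on \<open>[a, b]\<close>. Then \<open>deriv A t * y t\<close> is Riemann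
  integrable, and the gauge integral of the library is its Riemann integral.\<close>

definition path_integral :: "(real \<Rightarrow> real) \<Rightarrow> (real \<Rightarrow> real) \<Rightarrow> real \<Rightarrow> real \<Rightarrow> real" where
  "path_integral A y a b = A b * y b - A a * y a - integral {a..b} (\<lambda>t. deriv A t * y t)"

text \<open>\<open>\<integral>\<^bsub>-\<infinity>\<^esub>\<^bsup>b\<^esup> A(t) dY\<^sub>t\<close> exists as an almost sure limit and equals \<open>Z\<close> almost surely.\<close>

definition has_random_integral_at_bot ::
    "'a measure \<Rightarrow> (real \<Rightarrow> real) \<Rightarrow> (real \<Rightarrow> 'a \<Rightarrow> real) \<Rightarrow> real \<Rightarrow> ('a \<Rightarrow> real) \<Rightarrow> bool" where
  "has_random_integral_at_bot M A Y b Z \<longleftrightarrow>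
     (AE \<omega> in M. ((\<lambda>a. path_integral A (\<lambda>u. Y u \<omega>) a b) \<longlongrightarrow> Z \<omega>) at_bot)"

end

theory Submission
  imports Defs
begin

text \<open>
  Put \<open>\<beta> = \<alpha> - \<delta> / 2\<close>. The identity holds path by path, by associativity of integration:
  \<open>dY\<^sub>u = e\<^bsup>-\<beta> u\<^esup> dX\<^bsub>exp u\<^esub>\<close>, so the integral of \<open>e\<^bsup>\<beta> u\<^esup>\<close> along \<open>Y\<close> over \<open>[a, b]\<close> is
  \<open>X\<^bsub>exp b\<^esub> - X\<^bsub>exp a\<^esub>\<close>, and \<open>X\<^bsub>exp a\<^esub> \<longlongrightarrow> X\<^sub>0 = 0\<close> as \<open>a \<longlongrightarrow> -\<infinity>\<close> by right continuity at \<open>0\<close>. Since these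
  integrals are defined through integration by parts, associativity is a Fubini-type formula for the
  product of a continuously differentiable function with an indefinite integral.
\<close>

definition regulated_on :: "(real \<Rightarrow> real) \<Rightarrow> real set \<Rightarrow> bool" where
  "regulated_on f S \<longleftrightarrow>
     (\<forall>t\<in>S. (\<exists>l. (f \<longlongrightarrow> l) (at_left t)) \<and> (\<exists>r. (f \<longlongrightarrow> r) (at_right t)))"

lemma regulated_on_mult:
  assumes "regulated_on f S" "regulated_on g S"
  shows "regulated_on (\<lambda>t. f t * g t) S"
  using assms unfolding regulated_on_def by (blast intro: tendsto_mult)

lemma regulated_on_abs:
  assumes "regulated_on f S"
  shows "regulated_on (\<lambda>t. \<bar>f t\<bar>) S"
  using assms unfolding regulated_on_def by (blast intro: tendsto_rabs)

lemma regulated_on_isCont: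
  assumes "\<And>t. t \<in> S \<Longrightarrow> isCont f t"
  shows "regulated_on f S"
  unfolding regulated_on_def
  by (meson assms continuous_at_imp_continuous_at_within continuous_within)

lemma regulated_on_compose_strict_mono:
  assumes f: "regulated_on f (g ` S)" and g: "strict_mono g" and cont: "\<And>t. t \<in> S \<Longrightarrow> isCont g t"
  shows "regulated_on (\<lambda>t. f (g t)) S"
  unfolding regulated_on_def
proof (intro ballI)
  fix t assume t: "t \<in> S"
  obtain l r where l: "(f \<longlongrightarrow> l) (at_left (g t))" and r: "(f \<longlongrightarrow> r) (at_right (g t))"
    using f t unfolding regulated_on_def by blast
  have "(g \<longlongrightarrow> g t) (at t within A)" for A
    using cont[OF t] by (simp add: continuous_at_imp_continuous_at_within continuous_within[symmetric])
  moreover have "\<forall>\<^sub>F u in at_left t. g u \<in> {..<g t} \<and> g u \<noteq> g t"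
    unfolding eventually_at_filter
    by (intro always_eventually) (auto simp: strict_mono_less[OF g] strict_mono_eq[OF g])
  moreover have "\<forall>\<^sub>F u in at_right t. g u \<in> {g t<..} \<and> g u \<noteq> g t"
    unfolding eventually_at_filter
    by (intro always_eventually) (auto simp: strict_mono_less[OF g] strict_mono_eq[OF g])
  ultimately have "filterlim g (at_left (g t)) (at_left t)" "filterlim g (at_right (g t)) (at_right t)"
    by (auto simp: filterlim_at elim: eventually_mono)
  then show "(\<exists>l. ((\<lambda>t. f (g t)) \<longlongrightarrow> l) (at_left t)) \<and> (\<exists>r. ((\<lambda>t. f (g t)) \<longlongrightarrow> r) (at_right t))"
    using filterlim_compose[OF l] filterlim_compose[OF r] by blast
qed

lemma regulated_uniform_approx_bounded:
  assumes f: "regulated_on f {a..b}" and "a \<le> b" and "e > 0"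
  shows "(\<exists>g. g integrable_on {a..b} \<and> (\<forall>t\<in>{a..b}. \<bar>f t - g t\<bar> \<le> e)) \<and>
         (\<exists>B. \<forall>t\<in>{a..b}. \<bar>f t\<bar> \<le> B)"
  using \<open>a \<le> b\<close>
proof (induct rule: Bolzano)
  case (trans a b c)
  obtain g h where g: "g integrable_on {a..b}" "\<forall>t\<in>{a..b}. \<bar>f t - g t\<bar> \<le> e"
    and h: "h integrable_on {b..c}" "\<forall>t\<in>{b..c}. \<bar>f t - h t\<bar> \<le> e"
    using trans by blast
  obtain B C where B: "\<forall>t\<in>{a..b}. \<bar>f t\<bar> \<le> B" and C: "\<forall>t\<in>{b..c}. \<bar>f t\<bar> \<le> C"
    using trans by blast
  define k where "k t = (if t \<le> b then g t else h t)" for t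
  have "k integrable_on {a..b}"
    using g(1) by (rule integrable_eq) (simp add: k_def)
  moreover have "k integrable_on {b..c}"
    using integrable_spike_interior[of b c k h] h(1) by (auto simp: k_def)
  ultimately have "k integrable_on {a..c}"
    using Henstock_Kurzweil_Integration.integrable_combine trans(3,4) by blast
  moreover have "\<forall>t\<in>{a..c}. \<bar>f t - k t\<bar> \<le> e"
    using g(2) h(2) by (auto simp: k_def)
  moreover have "\<forall>t\<in>{a..c}. \<bar>f t\<bar> \<le> max B C"
    using B C by (metis atLeastAtMost_iff le_max_iff_disj linear)
  ultimately show ?case by blast
next
  case (local x)
  obtain l r where l: "(f \<longlongrightarrow> l) (at_left x)" and r: "(f \<longlongrightarrow> r) (at_right x)"
    using f local unfolding regulated_on_def by (metis atLeastAtMost_iff)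
  obtain d1 where d1: "d1 > 0" "\<And>t. t < x \<Longrightarrow> x - t < d1 \<Longrightarrow> \<bar>f t - l\<bar> < e"
    using tendstoD[OF l \<open>e > 0\<close>] unfolding eventually_at by (auto simp: dist_real_def)
  obtain d2 where d2: "d2 > 0" "\<And>t. t > x \<Longrightarrow> t - x < d2 \<Longrightarrow> \<bar>f t - r\<bar> < e"
    using tendstoD[OF r \<open>e > 0\<close>] unfolding eventually_at by (auto simp: dist_real_def)
  define g where "g t = (if t < x then l else if t = x then f x else r)" for t
  define B where "B = \<bar>l\<bar> + \<bar>r\<bar> + \<bar>f x\<bar> + e"
  show ?case
  proof (rule exI[of _ "min d1 d2"], intro conjI allI impI)
    show "0 < min d1 d2" using d1 d2 by simp
  next
    fix c d assume cd: "c \<le> x \<and> x \<le> d \<and> d - c < min d1 d2"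
    have "g integrable_on {c..x}" "g integrable_on {x..d}"
      using integrable_spike_interior[of c x g "\<lambda>_. l"] integrable_spike_interior[of x d g "\<lambda>_. r"]
      by (auto simp: g_def integrable_const_ivl)
    then have "g integrable_on {c..d}"
      using cd by (meson Henstock_Kurzweil_Integration.integrable_combine)
    moreover have near: "\<bar>f t - g t\<bar> \<le> e" if "t \<in> {c..d}" for t
      using d1(2)[of t] d2(2)[of t] that cd \<open>e > 0\<close> by (cases t x rule: linorder_cases) (auto simp: g_def)
    ultimately show "\<exists>g. g integrable_on {c..d} \<and> (\<forall>t\<in>{c..d}. \<bar>f t - g t\<bar> \<le> e)"
      by blast
    have "\<bar>f t\<bar> \<le> B" if "t \<in> {c..d}" for t
    proof -
      have "\<bar>g t\<bar> \<le> \<bar>l\<bar> + \<bar>r\<bar> + \<bar>f x\<bar>" by (auto simp: g_def)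
      then show ?thesis using near[OF that] unfolding B_def by linarith
    qed
    then show "\<exists>B. \<forall>t\<in>{c..d}. \<bar>f t\<bar> \<le> B" by blast
  qed
qed

lemma regulated_integrable:
  assumes "regulated_on f {a..b}"
  shows "f integrable_on {a..b}"
proof (cases "a \<le> b")
  case True
  have "f integrable_on cbox a b"
    using regulated_uniform_approx_bounded[OF assms True]
    by (intro integrable_uniform_limit) (simp, blast)
  then show ?thesis by simp
qed auto

lemma regulated_bounded:
  assumes "regulated_on f {a..b}"
  obtains B where "\<And>t. t \<in> {a..b} \<Longrightarrow> \<bar>f t\<bar> \<le> B"
proof (cases "a \<le> b")
  case True
  then show ?thesis
    using regulated_uniform_approx_bounded[OF assms, of 1] that by (metis zero_less_one)
qed (use that in auto)

text \<open>The indefinite integral need not be differentiable where \<open>f\<close> jumps, so the product rule is not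
  available; but the defect of the formula over \<open>[c, d]\<close> is \<open>O((d - c)\<^sup>2)\<close>, hence has derivative \<open>0\<close>.\<close>

lemma has_integral_deriv_times_indefinite_integral:
  fixes f \<phi> \<phi>' :: "real \<Rightarrow> real"
  assumes "a \<le> b" and f: "f integrable_on {a..b}" and B: "\<And>t. t \<in> {a..b} \<Longrightarrow> \<bar>f t\<bar> \<le> B"
    and der: "\<And>t. t \<in> {a..b} \<Longrightarrow> (\<phi> has_real_derivative \<phi>' t) (at t within {a..b})"
    and cont: "continuous_on {a..b} \<phi>'"
    and \<phi>f: "(\<lambda>t. \<phi> t * f t) integrable_on {a..b}"
  shows "((\<lambda>s. \<phi>' s * integral {a..s} f) has_integral
           \<phi> b * integral {a..b} f - integral {a..b} (\<lambda>t. \<phi> t * f t)) {a..b}"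
proof -
  define F where "F s = integral {a..s} f" for s
  have contF: "continuous_on {a..b} F"
    unfolding F_def by (rule indefinite_integral_continuous_1[OF f])
  have \<phi>'F: "(\<lambda>s. \<phi>' s * F s) integrable_on {a..b}"
    by (intro integrable_continuous_real continuous_intros cont contF)
  define K where "K s = \<phi> s * F s - integral {a..s} (\<lambda>s. \<phi>' s * F s) - integral {a..s} (\<lambda>t. \<phi> t * f t)" for s
  obtain L where L: "\<And>t. t \<in> {a..b} \<Longrightarrow> \<bar>\<phi>' t\<bar> \<le> L"
    using compact_imp_bounded[OF compact_continuous_image[OF cont compact_Icc]]
    unfolding bounded_iff by (metis image_eqI real_norm_def)
  have B0: "B \<ge> 0" using B[of a] \<open>a \<le> b\<close> by force
  have L0: "L \<ge> 0" using L[of a] \<open>a \<le> b\<close> by force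
  have Kdiff: "\<bar>K d - K c\<bar> \<le> 2 * (B * L) * (d - c)\<^sup>2" if cd: "a \<le> c" "c \<le> d" "d \<le> b" for c d
  proof -
    have sub: "{c..d} \<subseteq> {a..b}" "{a..d} \<subseteq> {a..b}" using that by auto
    have int: "h integrable_on {c..d}" "integral {a..d} h - integral {a..c} h = integral {c..d} h"
      if "h integrable_on {a..b}" for h :: "real \<Rightarrow> real"
      using Henstock_Kurzweil_Integration.integral_combine[of a c d h] integrable_on_subinterval[OF that] sub \<open>a \<le> c\<close> \<open>c \<le> d\<close>
      by (auto simp: algebra_simps)
    have d\<phi>: "(\<phi>' has_integral (\<phi> d - \<phi> c)) {c..d}" if "a \<le> c" "c \<le> d" "d \<le> b" for c d
      using that
      by (intro fundamental_theorem_of_calculus)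
        (auto simp: has_real_derivative_iff_has_vector_derivative[symmetric] intro!: DERIV_subset[OF der])
    have "F d - F s = integral {s..d} f" if "s \<in> {c..d}" for s
      using Henstock_Kurzweil_Integration.integral_combine[of a s d f] integrable_on_subinterval[OF f, of a d] that sub \<open>a \<le> c\<close>
      by (auto simp: F_def algebra_simps)
    moreover have "\<bar>integral {s..d} f\<bar> \<le> B * (d - s)" if "s \<in> {c..d}" for s
      using integrable_bound[of B f s d] that B0 B \<open>a \<le> c\<close> \<open>d \<le> b\<close>
        integrable_on_subinterval[OF f, of s d] by force
    ultimately have Fbound: "\<bar>F d - F s\<bar> \<le> B * (d - c)" if "s \<in> {c..d}" for s
      using that B0 by (smt (verit) atLeastAtMost_iff mult_left_mono)
    have \<phi>bound: "\<bar>\<phi> c - \<phi> s\<bar> \<le> L * (d - c)" if s: "s \<in> {c..d}" for s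
    proof -
      have "\<bar>\<phi> s - \<phi> c\<bar> \<le> L * (s - c)"
        using has_integral_bound_real[of L "{}" \<phi>' "\<phi> s - \<phi> c" c s] d\<phi>[of c s] s cd L L0 by auto
      also have "\<dots> \<le> L * (d - c)" using s L0 by (intro mult_left_mono) auto
      finally show ?thesis by simp
    qed
    have 1: "((\<lambda>s. \<phi>' s * (F d - F s)) has_integral
        ((\<phi> d - \<phi> c) * F d - integral {c..d} (\<lambda>s. \<phi>' s * F s))) {c..d}"
      using has_integral_diff[OF has_integral_mult_left[OF d\<phi>[OF that], of "F d"]
          integrable_integral[OF int(1)[OF \<phi>'F]]] by (simp add: algebra_simps)
    have 2: "((\<lambda>s. (\<phi> c - \<phi> s) * f s) has_integral
        (\<phi> c * (F d - F c) - integral {c..d} (\<lambda>t. \<phi> t * f t))) {c..d}"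
      using has_integral_diff[OF has_integral_mult_right[OF integrable_integral[OF int(1)[OF f]], of "\<phi> c"]
          integrable_integral[OF int(1)[OF \<phi>f]]] int(2)[OF f]
      by (simp add: algebra_simps F_def)
    have "\<bar>\<phi>' s * (F d - F s)\<bar> \<le> L * (B * (d - c))" if "s \<in> {c..d}" for s
      unfolding abs_mult using cd L0 that by (intro mult_mono L Fbound) auto
    then have "\<bar>(\<phi> d - \<phi> c) * F d - integral {c..d} (\<lambda>s. \<phi>' s * F s)\<bar> \<le> (L * (B * (d - c))) * (d - c)"
      using has_integral_bound_real[OF _ finite.emptyI 1, of "L * (B * (d - c))"] cd L0 B0 by simp
    moreover have "\<bar>(\<phi> c - \<phi> s) * f s\<bar> \<le> (L * (d - c)) * B" if "s \<in> {c..d}" for s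
      unfolding abs_mult using cd L0 that by (intro mult_mono \<phi>bound B) auto
    then have "\<bar>\<phi> c * (F d - F c) - integral {c..d} (\<lambda>t. \<phi> t * f t)\<bar> \<le> ((L * (d - c)) * B) * (d - c)"
      using has_integral_bound_real[OF _ finite.emptyI 2, of "(L * (d - c)) * B"] cd L0 B0 by simp
    moreover have "K d - K c = ((\<phi> d - \<phi> c) * F d - integral {c..d} (\<lambda>s. \<phi>' s * F s)) +
        (\<phi> c * (F d - F c) - integral {c..d} (\<lambda>t. \<phi> t * f t))"
      using int(2)[OF \<phi>'F] int(2)[OF \<phi>f] by (simp add: K_def algebra_simps)
    ultimately show ?thesis
      by (simp add: power2_eq_square algebra_simps)
  qed
  define C where "C = 2 * (B * L)"
  have Kabs: "\<bar>K y - K x\<bar> \<le> C * (y - x)\<^sup>2" if "x \<in> {a..b}" "y \<in> {a..b}" for x y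
    using Kdiff[of x y] Kdiff[of y x] that unfolding C_def
    by (cases "x \<le> y") (auto simp: abs_minus_commute power2_commute)
  have "(K has_real_derivative 0) (at x within {a..b})" if x: "x \<in> {a..b}" for x
  proof -
    have "((\<lambda>y. (K y - K x) / (y - x)) \<longlongrightarrow> 0) (at x within {a..b})"
    proof (rule Lim_null_comparison)
      show "\<forall>\<^sub>F y in at x within {a..b}. norm ((K y - K x) / (y - x)) \<le> C * \<bar>y - x\<bar>"
        unfolding eventually_at_filter
      proof (intro always_eventually allI impI)
        fix y assume "y \<noteq> x" "y \<in> {a..b}"
        then show "norm ((K y - K x) / (y - x)) \<le> C * \<bar>y - x\<bar>"
          using Kabs[OF x, of y]
          by (simp add: divide_le_eq power2_eq_square abs_mult_self_eq mult.assoc)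
      qed
      show "((\<lambda>y. C * \<bar>y - x\<bar>) \<longlongrightarrow> 0) (at x within {a..b})"
        by (auto intro!: tendsto_eq_intros)
    qed
    then show ?thesis by (simp add: has_field_derivative_iff)
  qed
  then obtain k where "\<forall>s\<in>{a..b}. K s = k"
    using has_field_derivative_zero_constant[of "{a..b}" K] by auto
  then have "K b = K a" using \<open>a \<le> b\<close> by simp
  moreover have "K a = 0" by (simp add: K_def F_def)
  ultimately have "integral {a..b} (\<lambda>s. \<phi>' s * F s) = \<phi> b * F b - integral {a..b} (\<lambda>t. \<phi> t * f t)"
    unfolding K_def by linarith
  then show ?thesis
    using integrable_integral[OF \<phi>'F] by (simp add: F_def)
qed

lemma exp_image_Icc: "exp ` {a..b} = {exp a..exp (b::real)}"
proof -
  have "x \<in> exp ` {a..b}" if "exp a \<le> x" "x \<le> exp b" for x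
  proof (rule image_eqI)
    have "x > 0" using exp_gt_zero[of a] that by linarith
    then show "x = exp (ln x)" "ln x \<in> {a..b}"
      using that by (auto simp: ln_ge_iff ln_le_cancel_iff[of x "exp b", simplified])
  qed
  then show ?thesis by auto
qed

lemma integral_exp_substitution:
  fixes f :: "real \<Rightarrow> real"
  assumes f: "regulated_on f {exp a..exp b}"
  shows "integral {exp a..exp b} f = integral {a..b} (\<lambda>v. exp v * f (exp v))"
proof -
  have "f absolutely_integrable_on {exp a..exp b}"
    using regulated_integrable[OF f] regulated_integrable[OF regulated_on_abs[OF f]]
    by (intro absolutely_integrable_onI) auto
  moreover have "(exp has_real_derivative exp v) (at v within {a..b})" for v :: real
    by (rule DERIV_subset[OF DERIV_exp]) simp
  ultimately show ?thesis
    using has_absolute_integral_change_of_variables_1'[of "{a..b}" exp exp f "integral {exp a..exp b} f"]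
    by (simp add: exp_image_Icc inj_on_def)
qed

lemma path_integral_combine:
  assumes "p \<le> q" "q \<le> r" "(\<lambda>t. deriv A t * y t) integrable_on {p..r}"
  shows "path_integral A y p q + path_integral A y q r = path_integral A y p r"
  using Henstock_Kurzweil_Integration.integral_combine[OF assms] unfolding path_integral_def by simp

lemma cadlag_regulated_on:
  assumes "cadlag_from_0 x" "\<And>t. t \<in> S \<Longrightarrow> t > 0"
  shows "regulated_on x S"
  using assms unfolding cadlag_from_0_def regulated_on_def by (meson less_imp_le)

lemma deriv_powr:
  assumes "u > 0"
  shows "deriv (\<lambda>u::real. u powr c) u = c * u powr (c - 1)"
  using assms by (intro DERIV_imp_deriv has_real_derivative_powr)

lemma regulated_on_deriv_powr_times:
  assumes x: "cadlag_from_0 x" and S: "\<And>t. t \<in> S \<Longrightarrow> t > 0"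
  shows "regulated_on (\<lambda>u. deriv (\<lambda>u. u powr c) u * x u) S"
proof (rule regulated_on_mult[OF regulated_on_isCont cadlag_regulated_on[OF x S]])
  fix t assume "t \<in> S"
  then have t: "t > 0" by (rule S)
  have "\<forall>\<^sub>F u in nhds t. c * u powr (c - 1) = deriv (\<lambda>u. u powr c) u"
    using eventually_nhds_in_open[of "{0<..}" t] t by (auto simp: deriv_powr elim!: eventually_mono)
  moreover have "isCont (\<lambda>u. c * u powr (c - 1)) t"
    using t by (intro continuous_intros) auto
  ultimately show "isCont (deriv (\<lambda>u. u powr c)) t"
    using isCont_cong by fast
qed

lemma path_integral_exp_associative:
  fixes x y :: "real \<Rightarrow> real"
  assumes x: "cadlag_from_0 x"
    and pos: "\<And>s. s \<ge> 0 \<Longrightarrow> y s = path_integral (\<lambda>u. u powr (- \<beta>)) x 1 (exp s)"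
    and neg: "\<And>s. s < 0 \<Longrightarrow> y s = - path_integral (\<lambda>u. u powr (- \<beta>)) x (exp s) 1"
    and "a \<le> b"
  shows "path_integral (\<lambda>u. exp (u * \<beta>)) y a b = x (exp b) - x (exp a)"
proof -
  let ?A = "\<lambda>u::real. u powr (- \<beta>)"
  define f where "f v = exp (- \<beta> * v) * x (exp v)" for v
  define F where "F s = integral {a..s} f" for s
  define c where "c = y a - exp (- \<beta> * a) * x (exp a)"
  have reg: "regulated_on (\<lambda>u. deriv ?A u * x u) {exp p..r}" for p r
    by (intro regulated_on_deriv_powr_times x) (meson atLeastAtMost_iff exp_gt_zero less_le_trans)
  have comb: "path_integral ?A x (exp p) q + path_integral ?A x q r = path_integral ?A x (exp p) r"
    if "exp p \<le> q" "q \<le> r" for p q r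
    using that by (intro path_integral_combine regulated_integrable reg)
  have y_incr: "y s = y a + path_integral ?A x (exp a) (exp s)" if "a \<le> s" for s
    using comb[of 0 "exp a" "exp s"] comb[of a 1 "exp s"] comb[of a "exp s" 1] pos neg that
    by (cases "a < 0"; cases "s < 0") auto
  have x_exp: "regulated_on (\<lambda>v. x (exp v)) S" for S
    by (rule regulated_on_compose_strict_mono[OF cadlag_regulated_on[OF x]]) (auto simp: strict_mono_def)
  have f_reg: "regulated_on f S" for S
    unfolding f_def by (rule regulated_on_mult[OF regulated_on_isCont x_exp]) (intro continuous_intros)
  have y_eq: "y s = exp (- \<beta> * s) * x (exp s) + \<beta> * F s + c" if "a \<le> s" for s
  proof -
    have "integral {exp a..exp s} (\<lambda>u. deriv ?A u * x u) =
        integral {a..s} (\<lambda>v. exp v * (deriv ?A (exp v) * x (exp v)))"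
      by (intro integral_exp_substitution reg)
    also have "(\<lambda>v. exp v * (deriv ?A (exp v) * x (exp v))) = (\<lambda>v. - \<beta> * f v)"
    proof
      fix v
      have E: "exp v * exp ((- \<beta> - 1) * v) = exp (- \<beta> * v)"
        by (simp add: mult_exp_exp algebra_simps)
      have D: "deriv ?A (exp v) = - \<beta> * exp ((- \<beta> - 1) * v)"
        unfolding deriv_powr[OF exp_gt_zero] by (simp add: powr_def)
      show "exp v * (deriv ?A (exp v) * x (exp v)) = - \<beta> * f v"
        unfolding f_def D E[symmetric] by (simp only: mult_ac)
    qed
    finally show ?thesis
      using y_incr[OF that] by (simp add: path_integral_def c_def F_def powr_def)
  qed
  have e\<phi>: "((\<lambda>s. exp (s * \<beta>)) has_real_derivative \<beta> * exp (s * \<beta>)) (at s within S)" for s S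
    by (auto intro!: derivative_eq_intros)
  have \<phi>f: "(\<lambda>t. exp (t * \<beta>) * f t) = (\<lambda>v. x (exp v))"
    by (auto simp: f_def exp_minus field_simps)
  obtain B where B: "\<And>t. t \<in> {a..b} \<Longrightarrow> \<bar>f t\<bar> \<le> B"
    using regulated_bounded[OF f_reg] by blast
  have X: "(\<lambda>v. x (exp v)) integrable_on {a..b}"
    by (rule regulated_integrable[OF x_exp])
  have "continuous_on {a..b} (\<lambda>s. \<beta> * exp (s * \<beta>))"
    by (intro continuous_intros)
  then have "((\<lambda>s. \<beta> * exp (s * \<beta>) * F s) has_integral
      exp (b * \<beta>) * F b - integral {a..b} (\<lambda>v. x (exp v))) {a..b}"
    using has_integral_deriv_times_indefinite_integral[OF \<open>a \<le> b\<close> regulated_integrable[OF f_reg] B e\<phi>]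
      X unfolding \<phi>f F_def by simp
  then have 1: "((\<lambda>s. \<beta> * (\<beta> * exp (s * \<beta>) * F s)) has_integral
      \<beta> * (exp (b * \<beta>) * F b - integral {a..b} (\<lambda>v. x (exp v)))) {a..b}"
    by (rule has_integral_mult_right)
  have 2: "((\<lambda>v. \<beta> * x (exp v)) has_integral \<beta> * integral {a..b} (\<lambda>v. x (exp v))) {a..b}"
    using X by (intro has_integral_mult_right integrable_integral)
  have 3: "((\<lambda>s. \<beta> * exp (s * \<beta>) * c) has_integral (exp (b * \<beta>) - exp (a * \<beta>)) * c) {a..b}"
    using e\<phi> \<open>a \<le> b\<close> by (intro has_integral_mult_left fundamental_theorem_of_calculus)
      (auto simp: has_real_derivative_iff_has_vector_derivative[symmetric])
  have "((\<lambda>s. deriv (\<lambda>u. exp (u * \<beta>)) s * y s) has_integral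
      \<beta> * (exp (b * \<beta>) * F b) + (exp (b * \<beta>) - exp (a * \<beta>)) * c) {a..b}"
  proof (rule has_integral_eq[rotated])
    show "((\<lambda>s. \<beta> * (\<beta> * exp (s * \<beta>) * F s) + \<beta> * x (exp s) + \<beta> * exp (s * \<beta>) * c) has_integral
      \<beta> * (exp (b * \<beta>) * F b) + (exp (b * \<beta>) - exp (a * \<beta>)) * c) {a..b}"
      using has_integral_add[OF has_integral_add[OF 1 2] 3] by (simp add: algebra_simps)
    fix s assume s: "s \<in> {a..b}"
    have "deriv (\<lambda>u. exp (u * \<beta>)) s = \<beta> * exp (s * \<beta>)"
      by (rule DERIV_imp_deriv[OF e\<phi>])
    then show "\<beta> * (\<beta> * exp (s * \<beta>) * F s) + \<beta> * x (exp s) + \<beta> * exp (s * \<beta>) * c =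
        deriv (\<lambda>u. exp (u * \<beta>)) s * y s"
      using y_eq[of s] s by (simp add: algebra_simps exp_minus)
  qed
  then have "integral {a..b} (\<lambda>s. deriv (\<lambda>u. exp (u * \<beta>)) s * y s) =
      \<beta> * (exp (b * \<beta>) * F b) + (exp (b * \<beta>) - exp (a * \<beta>)) * c"
    by (rule integral_unique)
  moreover have "F a = 0" by (simp add: F_def)
  ultimately show ?thesis
    using y_eq[of a] y_eq[OF \<open>a \<le> b\<close>] unfolding path_integral_def
    by (simp add: algebra_simps exp_minus)
qed

theorem theorem2p2:
  fixes M :: "'a measure"
    and X Y :: "real \<Rightarrow> 'a \<Rightarrow> real"
    and \<alpha> \<delta> t :: real
  assumes "prob_space M"
    and "additive_process M X"
    and "dilatively_stable M \<alpha> \<delta> X"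
    and "AE \<omega> in M. \<forall>s\<ge>0.
           Y s \<omega> = path_integral (\<lambda>u. u powr (- \<alpha> + \<delta> / 2)) (\<lambda>u. X u \<omega>) 1 (exp s)"
    and "AE \<omega> in M. \<forall>s<0.
           Y s \<omega> = - path_integral (\<lambda>u. u powr (- \<alpha> + \<delta> / 2)) (\<lambda>u. X u \<omega>) (exp s) 1"
    and "t > 0"
  shows "has_random_integral_at_bot M (\<lambda>u. exp (u * (\<alpha> - \<delta> / 2))) Y (ln t) (X t)"
proof -
  have "AE \<omega> in M. cadlag_from_0 (\<lambda>t. X t \<omega>)" "AE \<omega> in M. X 0 \<omega> = 0"
    using assms(2) unfolding additive_process_def by auto
  with assms(4,5) show ?thesis
    unfolding has_random_integral_at_bot_def
  proof eventually_elim
    case (elim \<omega>)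
    let ?A = "\<lambda>u. exp (u * (\<alpha> - \<delta> / 2))"
    have \<beta>: "- \<alpha> + \<delta> / 2 = - (\<alpha> - \<delta> / 2)" by simp
    have assoc: "path_integral ?A (\<lambda>u. Y u \<omega>) a (ln t) = X t \<omega> - X (exp a) \<omega>" if "a \<le> ln t" for a
      using path_integral_exp_associative[OF elim(3), of "\<lambda>u. Y u \<omega>" "\<alpha> - \<delta> / 2", OF _ _ that]
        elim(1,2) \<open>t > 0\<close> unfolding \<beta> by simp
    have "((\<lambda>u. X u \<omega>) \<longlongrightarrow> 0) (at_right 0)"
      using elim(3,4) unfolding cadlag_from_0_def by (metis order_refl)
    moreover have "filterlim exp (at_right 0) (at_bot :: real filter)"
      by (rule exp_at_bot[THEN filterlim_at_withinI]) auto
    ultimately have "((\<lambda>a. X (exp a) \<omega>) \<longlongrightarrow> 0) at_bot"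
      by (rule filterlim_compose)
    then have "((\<lambda>a. X t \<omega> - X (exp a) \<omega>) \<longlongrightarrow> X t \<omega>) at_bot"
      by (auto intro!: tendsto_eq_intros)
    then show ?case
      by (rule Lim_transform_eventually)
        (use assoc in \<open>auto intro: eventually_mono[OF eventually_le_at_bot[of "ln t"]]\<close>)
  qed
qed

end
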